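(* Let $P_k$ denote the path with $k$ vertices and $C_k$ the cycle with $k$ vertices. Then: $\chi_{D_L}(P_{2t})=2$ and $\chi_{D_L}(P_{2t+1})=3$ for every $t\geq 1$; $\chi_{D_L}(C_4)=4$, $\chi_{D_L}(C_5)=3$, $\chi_{D_L}(C_6)=4$; $\chi_{D_L}(C_{2m+1})=3$ for every $m\geq 3$; $\chi_{D_L}(C_{2n})=3$ for every $n\geq 4$.
   Context: A vertex coloring $f$ of a graph $G$ is distinguishing if the only automorphism $\phi$ of $G$ with $f(\phi(v))=f(v)$ for all vertices $v$ is the identity. A list assignment $L=\{L(v)\}_{v\in V(G)}$ assigns to each vertex a finite set of colors; $G$ is properly $L$-distinguishable if there is a proper vertex coloring $f$ of $G$ which is distinguishing and satisfies $f(v)\in L(v)$ for all $v$. The list-distinguishing chromatic number $\chi_{D_L}(G)$ is the minimum integer $k$ such that $G$ is properly $L$-distinguishable for every list assignment $L$ with $|L(v)|=k$ for all $v\in V(G)$. *)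

theory Defs
  imports Main
begin

text \<open>
  An undirected graph is a pair of a vertex set and a set of edges, an edge being the set of
  its two endpoints.
\<close>

type_synonym 'v ugraph = "'v set \<times> 'v set set"

abbreviation vertices :: "'v ugraph \<Rightarrow> 'v set" where
  "vertices G \<equiv> fst G"

abbreviation edges :: "'v ugraph \<Rightarrow> 'v set set" where
  "edges G \<equiv> snd G"

definition finite_simple_graph :: "'v ugraph \<Rightarrow> bool" where
  "finite_simple_graph G \<longleftrightarrow>
     finite (vertices G) \<and> (\<forall>e\<in>edges G. e \<subseteq> vertices G \<and> card e = 2)"

definition graph_automorphism :: "'v ugraph \<Rightarrow> ('v \<Rightarrow> 'v) \<Rightarrow> bool" where
  "graph_automorphism G \<phi> \<longleftrightarrow>
     bij_betw \<phi> (vertices G) (vertices G) \<and>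
     (\<forall>u\<in>vertices G. \<forall>v\<in>vertices G. {\<phi> u, \<phi> v} \<in> edges G \<longleftrightarrow> {u, v} \<in> edges G)"

definition proper_coloring :: "'v ugraph \<Rightarrow> ('v \<Rightarrow> 'c) \<Rightarrow> bool" where
  "proper_coloring G f \<longleftrightarrow>
     (\<forall>u\<in>vertices G. \<forall>v\<in>vertices G. {u, v} \<in> edges G \<longrightarrow> f u \<noteq> f v)"

definition distinguishing :: "'v ugraph \<Rightarrow> ('v \<Rightarrow> 'c) \<Rightarrow> bool" where
  "distinguishing G f \<longleftrightarrow>
     (\<forall>\<phi>. graph_automorphism G \<phi> \<and> (\<forall>v\<in>vertices G. f (\<phi> v) = f v)
        \<longrightarrow> (\<forall>v\<in>vertices G. \<phi> v = v))"

definition properly_list_distinguishable :: "'v ugraph \<Rightarrow> ('v \<Rightarrow> 'c set) \<Rightarrow> bool" where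
  "properly_list_distinguishable G L \<longleftrightarrow>
     (\<exists>f. proper_coloring G f \<and> distinguishing G f \<and> (\<forall>v\<in>vertices G. f v \<in> L v))"

text \<open>
  Colors are natural numbers. For a finite graph this is no restriction: the lists involve
  only finitely many colors, which can be renamed injectively.
\<close>

definition list_distinguishing_chromatic_number :: "'v ugraph \<Rightarrow> nat" where
  "list_distinguishing_chromatic_number G =
     (LEAST k. \<forall>L :: 'v \<Rightarrow> nat set.
        (\<forall>v\<in>vertices G. finite (L v) \<and> card (L v) = k) \<longrightarrow> properly_list_distinguishable G L)"

definition path_graph :: "nat \<Rightarrow> nat ugraph" where
  "path_graph k = ({..<k}, {{i, Suc i} | i. Suc i < k})"

text \<open>This is the cycle only for \<open>k \<ge> 3\<close>; for smaller \<open>k\<close> the value is a junk value.\<close>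

definition cycle_graph :: "nat \<Rightarrow> nat ugraph" where
  "cycle_graph k = ({..<k}, {{i, Suc i mod k} | i. i < k})"

lemma finite_simple_graph_path_graph: "finite_simple_graph (path_graph k)"
  by (auto simp: finite_simple_graph_def path_graph_def)

lemma finite_simple_graph_cycle_graph:
  assumes "k \<ge> 3"
  shows "finite_simple_graph (cycle_graph k)"
proof -
  have "i \<noteq> Suc i mod k" if "i < k" for i
    using that assms by (cases "Suc i = k") auto
  then show ?thesis
    using assms by (auto simp: finite_simple_graph_def cycle_graph_def card_2_iff)
qed

end

theory Submission
  imports Defs
begin

text \<open>
  A path or a cycle has maximum degree two, so an automorphism is determined by its values at
  two consecutive vertices; in particular a coloring of a cycle is distinguishing as soon as
  the color of vertex 0 is unique and the two neighbours of 0 get different colors.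

  For paths, greedy coloring suffices: the reversal of an even path swaps two adjacent vertices,
  and on an odd path the third color is used to make the two ends differ.
  For cycles whose lists are not all equal, there are adjacent vertices \<open>x\<close>, \<open>y\<close> and a color \<open>c\<close> in
  \<open>L x\<close> but not in \<open>L y\<close>. Give \<open>x\<close> the color \<open>c\<close>, delete \<open>c\<close> from the other lists, and color
  greedily around the cycle, ending in \<open>y\<close>; its list has lost nothing, so it can avoid both its
  predecessor and the other neighbour of \<open>x\<close>. If all lists are equal, explicit colorings work:
  \<open>cabab\<dots>ab\<close> for odd cycles, \<open>cabcabab\<dots>ab\<close> for even cycles of length at least 8, and
  \<open>cdab\<dots>ab\<close> if there are four colors.
\<close>

section \<open>Automorphisms and lists\<close>

text \<open>The constant lists \<open>{..<j}\<close> grow with \<open>j\<close>, so one failure at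
  \<open>k\<close> excludes every \<open>j \<le> k\<close>. A lower bound is thereby reduced to
  ordinary colorings with \<open>k\<close> colors.\<close>

lemma list_distinguishing_chromatic_number_eq_Suc:
  fixes G :: "'v ugraph"
  assumes lower: "\<not> properly_list_distinguishable G (\<lambda>_. {..<k})"
    and upper: "\<And>L :: 'v \<Rightarrow> nat set.
      (\<forall>v\<in>vertices G. finite (L v) \<and> card (L v) = Suc k) \<Longrightarrow> properly_list_distinguishable G L"
  shows "list_distinguishing_chromatic_number G = Suc k"
  unfolding list_distinguishing_chromatic_number_def
proof (rule Least_equality)
  show "\<forall>L :: 'v \<Rightarrow> nat set. (\<forall>v\<in>vertices G. finite (L v) \<and> card (L v) = Suc k) \<longrightarrow>
      properly_list_distinguishable G L"
    using upper by blast
next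
  fix j
  assume j: "\<forall>L :: 'v \<Rightarrow> nat set. (\<forall>v\<in>vertices G. finite (L v) \<and> card (L v) = j) \<longrightarrow>
      properly_list_distinguishable G L"
  show "Suc k \<le> j"
  proof (rule ccontr)
    assume "\<not> Suc k \<le> j"
    moreover have "properly_list_distinguishable G (\<lambda>_. {..<j})"
      using j by simp
    ultimately have "properly_list_distinguishable G (\<lambda>_. {..<k})"
      unfolding properly_list_distinguishable_def by fastforce
    then show False
      using lower by blast
  qed
qed

section \<open>Composition and inversion of automorphisms, transport of lists\<close>

lemma graph_automorphism_in_vertices:
  "graph_automorphism G \<phi> \<Longrightarrow> v \<in> vertices G \<Longrightarrow> \<phi> v \<in> vertices G"
  by (auto simp: graph_automorphism_def bij_betw_def)

lemma graph_automorphism_eq_iff: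
  "graph_automorphism G \<phi> \<Longrightarrow> u \<in> vertices G \<Longrightarrow> v \<in> vertices G \<Longrightarrow> \<phi> u = \<phi> v \<longleftrightarrow> u = v"
  by (auto simp: graph_automorphism_def bij_betw_def inj_on_def)

lemma graph_automorphism_edge_iff:
  "graph_automorphism G \<phi> \<Longrightarrow> u \<in> vertices G \<Longrightarrow> v \<in> vertices G \<Longrightarrow>
    {\<phi> u, \<phi> v} \<in> edges G \<longleftrightarrow> {u, v} \<in> edges G"
  by (auto simp: graph_automorphism_def)

lemma graph_automorphism_comp:
  assumes "graph_automorphism G \<phi>" "graph_automorphism G \<psi>"
  shows "graph_automorphism G (\<phi> \<circ> \<psi>)"
  using assms graph_automorphism_in_vertices[OF assms(2)]
  by (auto simp: graph_automorphism_def intro: bij_betw_trans)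

lemma graph_automorphism_inv_into:
  assumes "graph_automorphism G \<phi>"
  shows "graph_automorphism G (inv_into (vertices G) \<phi>)"
proof -
  let ?\<sigma> = "inv_into (vertices G) \<phi>"
  have bij: "bij_betw \<phi> (vertices G) (vertices G)"
    using assms by (simp add: graph_automorphism_def)
  have \<sigma>: "bij_betw ?\<sigma> (vertices G) (vertices G)"
    using bij by (rule bij_betw_inv_into)
  have "{?\<sigma> u, ?\<sigma> v} \<in> edges G \<longleftrightarrow> {u, v} \<in> edges G"
    if "u \<in> vertices G" "v \<in> vertices G" for u v
    using graph_automorphism_edge_iff[OF assms, of "?\<sigma> u" "?\<sigma> v"] that
      bij_betwE[OF \<sigma>] bij_betw_inv_into_right[OF bij] by simp
  then show ?thesis
    using \<sigma> by (simp add: graph_automorphism_def)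
qed

text \<open>If \<open>g\<close> is good for \<open>L \<circ> \<rho>\<close>, then \<open>g\<close>
  composed with the inverse of \<open>\<rho>\<close> is good for \<open>L\<close>. This allows a
  cycle to be rotated so that a chosen vertex becomes vertex 0.\<close>

lemma properly_list_distinguishable_automorphism:
  assumes \<rho>: "graph_automorphism G \<rho>"
    and "properly_list_distinguishable G (L \<circ> \<rho>)"
  shows "properly_list_distinguishable G L"
proof -
  let ?V = "vertices G"
  obtain g where proper: "proper_coloring G g" and dist: "distinguishing G g"
    and g: "\<And>v. v \<in> ?V \<Longrightarrow> g v \<in> L (\<rho> v)"
    using assms(2) by (auto simp: properly_list_distinguishable_def)
  define \<sigma> where "\<sigma> = inv_into ?V \<rho>"
  have \<sigma>: "graph_automorphism G \<sigma>"
    unfolding \<sigma>_def using \<rho> by (rule graph_automorphism_inv_into)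
  have bij: "bij_betw \<rho> ?V ?V"
    using \<rho> by (simp add: graph_automorphism_def)
  have \<rho>\<sigma>: "\<rho> (\<sigma> v) = v" if "v \<in> ?V" for v
    using bij_betw_inv_into_right[OF bij that] by (simp add: \<sigma>_def)
  have \<sigma>\<rho>: "\<sigma> (\<rho> v) = v" if "v \<in> ?V" for v
    using bij_betw_inv_into_left[OF bij that] by (simp add: \<sigma>_def)
  have in_V: "\<sigma> v \<in> ?V" "\<rho> v \<in> ?V" if "v \<in> ?V" for v
    using that graph_automorphism_in_vertices[OF \<rho>] graph_automorphism_in_vertices[OF \<sigma>] by auto
  have "proper_coloring G (g \<circ> \<sigma>)"
    using proper in_V graph_automorphism_edge_iff[OF \<sigma>] by (simp add: proper_coloring_def)
  moreover have "distinguishing G (g \<circ> \<sigma>)"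
    unfolding distinguishing_def
  proof (intro allI impI ballI, elim conjE)
    fix \<phi> v
    assume \<phi>: "graph_automorphism G \<phi>" and fixed: "\<forall>v\<in>?V. (g \<circ> \<sigma>) (\<phi> v) = (g \<circ> \<sigma>) v"
      and v: "v \<in> ?V"
    \<comment> \<open>Conjugation by \<open>\<rho>\<close> turns an automorphism preserving
      \<open>g \<circ> \<sigma>\<close> into one preserving \<open>g\<close>, which is the identity
      on the vertices.\<close>
    have "graph_automorphism G (\<sigma> \<circ> (\<phi> \<circ> \<rho>))"
      using \<rho> \<sigma> \<phi> by (intro graph_automorphism_comp)
    moreover have "g ((\<sigma> \<circ> (\<phi> \<circ> \<rho>)) u) = g u" if "u \<in> ?V" for u
      using fixed in_V(2)[OF that] \<sigma>\<rho>[OF that] by simp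
    ultimately have "(\<sigma> \<circ> (\<phi> \<circ> \<rho>)) u = u" if "u \<in> ?V" for u
      using dist that unfolding distinguishing_def by blast
    from this[of "\<sigma> v"] have "\<sigma> (\<phi> v) = \<sigma> v"
      using v in_V \<rho>\<sigma> by simp
    then show "\<phi> v = v"
      using graph_automorphism_eq_iff[OF \<sigma>] v graph_automorphism_in_vertices[OF \<phi>] by simp
  qed
  moreover have "\<forall>v\<in>?V. (g \<circ> \<sigma>) v \<in> L v"
    using g in_V \<rho>\<sigma> by fastforce
  ultimately show ?thesis
    unfolding properly_list_distinguishable_def by blast
qed

section \<open>Rigidity of automorphisms in maximum degree two\<close>

text \<open>Induction along the path 0, 1, 2, ...: if the maps agree at \<open>j\<close> and
  \<open>Suc j\<close>, then both images of \<open>Suc (Suc j)\<close> are neighbours of the common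
  image of \<open>Suc j\<close> and differ from the common image of \<open>j\<close>. Degree two
  leaves only one such vertex.\<close>

lemma graph_automorphism_eqI_max_degree_2:
  assumes V: "vertices G = {..<n::nat}"
    and consec: "\<And>i. Suc i < n \<Longrightarrow> {i, Suc i} \<in> edges G"
    and deg: "\<And>v a b c. {v, a} \<in> edges G \<Longrightarrow> {v, b} \<in> edges G \<Longrightarrow> {v, c} \<in> edges G \<Longrightarrow>
      a = b \<or> b = c \<or> a = c"
    and \<phi>: "graph_automorphism G \<phi>" and \<psi>: "graph_automorphism G \<psi>"
    and start: "\<phi> 0 = \<psi> 0" "\<phi> (Suc 0) = \<psi> (Suc 0)"
  shows "i < n \<Longrightarrow> \<phi> i = \<psi> i"
proof (induction i rule: less_induct)
  case (less i)
  consider "i = 0" | "i = Suc 0" | j where "i = Suc (Suc j)"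
    by (metis not0_implies_Suc)
  then show ?case
  proof cases
    case 3
    have IH: "\<phi> j = \<psi> j" "\<phi> (Suc j) = \<psi> (Suc j)"
      using less 3 by auto
    have *: "{\<chi> (Suc j), \<chi> j} \<in> edges G" "{\<chi> (Suc j), \<chi> i} \<in> edges G" "\<chi> j \<noteq> \<chi> i"
      if "graph_automorphism G \<chi>" for \<chi>
      using graph_automorphism_edge_iff[OF that] graph_automorphism_eq_iff[OF that]
        consec[of j] consec[of "Suc j"] less.prems 3 V by (auto simp: insert_commute)
    show ?thesis
      using deg[of "\<phi> (Suc j)" "\<phi> j" "\<phi> i" "\<psi> i"] *[OF \<phi>] *[OF \<psi>] IH by auto
  qed (use start in auto)
qed

lemma graph_automorphism_involution:
  assumes "\<And>v. v \<in> vertices G \<Longrightarrow> \<phi> v \<in> vertices G" "\<And>v. v \<in> vertices G \<Longrightarrow> \<phi> (\<phi> v) = v"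
    and "\<And>u v. u \<in> vertices G \<Longrightarrow> v \<in> vertices G \<Longrightarrow> {u, v} \<in> edges G \<Longrightarrow> {\<phi> u, \<phi> v} \<in> edges G"
  shows "graph_automorphism G \<phi>"
  unfolding graph_automorphism_def
proof (intro conjI ballI)
  show "bij_betw \<phi> (vertices G) (vertices G)"
    using assms(1,2) by (intro bij_betw_byWitness[where f' = \<phi>]) auto
  show "{\<phi> u, \<phi> v} \<in> edges G \<longleftrightarrow> {u, v} \<in> edges G" if "u \<in> vertices G" "v \<in> vertices G" for u v
    using assms(3)[of u v] assms(3)[of "\<phi> u" "\<phi> v"] assms(1,2) that by auto
qed

lemma graph_automorphism_id: "graph_automorphism G (\<lambda>v. v)"
  by (rule graph_automorphism_involution) auto

lemma not_distinguishingI: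
  assumes "graph_automorphism G \<phi>" "\<And>v. v \<in> vertices G \<Longrightarrow> f (\<phi> v) = f v"
    and "v \<in> vertices G" "\<phi> v \<noteq> v"
  shows "\<not> distinguishing G f"
  using assms unfolding distinguishing_def by blast

section \<open>Greedy choice and alternating colorings\<close>

text \<open>A list of two colors always contains one that differs from the preceding color. The
  first list may be a singleton, so the color of the starting vertex can be prescribed.\<close>

lemma greedy_sequence:
  assumes "M 0 \<noteq> {}" "\<And>i. 0 < i \<Longrightarrow> i < n \<Longrightarrow> finite (M i) \<and> 2 \<le> card (M i)"
  shows "\<exists>g :: nat \<Rightarrow> 'c. (\<forall>i<n. g i \<in> M i) \<and> (\<forall>i. Suc i < n \<longrightarrow> g (Suc i) \<noteq> g i)"
  using assms
proof (induction n)
  case (Suc n)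
  then obtain g where g: "\<forall>i<n. g i \<in> M i" "\<forall>i. Suc i < n \<longrightarrow> g (Suc i) \<noteq> g i"
    by auto
  obtain y where y: "y \<in> M n" "0 < n \<longrightarrow> y \<noteq> g (n - 1)"
  proof (cases n)
    case 0
    then show ?thesis
      using Suc.prems(1) that by auto
  next
    case (Suc m)
    then have "finite (M n)" "2 \<le> card (M n)"
      using Suc.prems(2) by auto
    then have "\<not> M n \<subseteq> {g m}"
      using card_mono[of "{g m}" "M n"] by auto
    then show ?thesis
      using that Suc by auto
  qed
  show ?case
    using g y by (intro exI[of _ "g(n := y)"]) (auto simp: less_Suc_eq)
qed simp

lemma ex_avoiding_two:
  assumes "3 \<le> card A"
  shows "\<exists>y\<in>A. y \<noteq> a \<and> y \<noteq> b"
proof (rule ccontr)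
  assume "\<not> ?thesis"
  then have "A \<subseteq> {a, b}"
    by auto
  then have "card A \<le> card {a, b}"
    by (intro card_mono) auto
  also have "\<dots> \<le> 2"
    by (simp add: card_insert_if)
  finally show False
    using assms by simp
qed

text \<open>With colors 0 and 1 each vertex forces the next, so the coloring is fixed by
  \<open>f 0\<close> and parity. In the lower bounds, a symmetry preserving parity therefore
  preserves the coloring.\<close>

lemma two_coloring_alternates:
  fixes f :: "nat \<Rightarrow> nat"
  assumes "\<And>i. i < n \<Longrightarrow> f i < 2" "\<And>i. Suc i < n \<Longrightarrow> f i \<noteq> f (Suc i)"
  shows "i < n \<Longrightarrow> f i = (f 0 + i) mod 2"
proof (induction i)
  case 0
  then show ?case
    using assms(1)[of 0] by simp
next
  case (Suc i)
  then have "f i = (f 0 + i) mod 2" "f (Suc i) < 2" "f i \<noteq> f (Suc i)"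
    using assms(1)[of "Suc i"] assms(2)[of i] by auto
  then show ?case
    by presburger
qed

section \<open>Paths\<close>

lemma vertices_path_graph [simp]: "vertices (path_graph k) = {..<k}"
  by (simp add: path_graph_def)

lemma edge_path_graph_iff:
  "{u, v} \<in> edges (path_graph k) \<longleftrightarrow> u < k \<and> v < k \<and> (v = Suc u \<or> u = Suc v)"
  by (auto simp: path_graph_def doubleton_eq_iff)

lemma proper_coloring_path_graph_iff:
  "proper_coloring (path_graph k) f \<longleftrightarrow> (\<forall>i. Suc i < k \<longrightarrow> f i \<noteq> f (Suc i))"
  by (auto simp: proper_coloring_def edge_path_graph_iff)

lemma path_graph_automorphism_eqI:
  assumes "graph_automorphism (path_graph k) \<phi>" "graph_automorphism (path_graph k) \<psi>"
    and "\<phi> 0 = \<psi> 0" "\<phi> (Suc 0) = \<psi> (Suc 0)" "i < k"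
  shows "\<phi> i = \<psi> i"
  by (rule graph_automorphism_eqI_max_degree_2[OF _ _ _ assms(1-4,5)])
    (auto simp: edge_path_graph_iff)

lemma graph_automorphism_path_reversal: "graph_automorphism (path_graph k) (\<lambda>i. k - 1 - i)"
  by (rule graph_automorphism_involution) (auto simp: edge_path_graph_iff)

text \<open>Vertex 0 has a single neighbour, so its image is an end of the path. The image of vertex
  1 is then forced, and rigidity identifies the map with the identity or the reversal.\<close>

lemma path_graph_automorphism_cases:
  assumes k: "2 \<le> k" and \<phi>: "graph_automorphism (path_graph k) \<phi>"
  shows "(\<forall>i<k. \<phi> i = i) \<or> (\<forall>i<k. \<phi> i = k - 1 - i)"
proof -
  have lt: "\<phi> i < k" if "i < k" for i
    using graph_automorphism_in_vertices[OF \<phi>, of i] that by simp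
  have end_vertex: "\<phi> 0 = 0 \<or> \<phi> 0 = k - 1"
  proof (rule ccontr)
    assume "\<not> ?thesis"
    then have inner: "0 < \<phi> 0" "Suc (\<phi> 0) < k"
      using lt[of 0] k by auto
    \<comment> \<open>An inner vertex \<open>\<phi> 0\<close> has two neighbours. By surjectivity
      they have preimages \<open>a\<close> and \<open>b\<close>, both adjacent to 0 and hence equal,
      a contradiction.\<close>
    have "\<phi> ` {..<k} = {..<k}"
      using \<phi> by (simp add: graph_automorphism_def bij_betw_def)
    then have "\<phi> 0 - 1 \<in> \<phi> ` {..<k}" "Suc (\<phi> 0) \<in> \<phi> ` {..<k}"
      using inner by auto
    then obtain a b where ab: "a < k" "b < k" "\<phi> a = \<phi> 0 - 1" "\<phi> b = Suc (\<phi> 0)"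
      by auto
    have "{0, a} \<in> edges (path_graph k)" "{0, b} \<in> edges (path_graph k)"
      using graph_automorphism_edge_iff[OF \<phi>, of 0 a] graph_automorphism_edge_iff[OF \<phi>, of 0 b]
        ab inner k by (auto simp: edge_path_graph_iff)
    then have "a = b"
      by (simp add: edge_path_graph_iff)
    then show False
      using ab by simp
  qed
  have next_vertex: "\<phi> (Suc 0) = Suc (\<phi> 0) \<or> \<phi> 0 = Suc (\<phi> (Suc 0))" "\<phi> (Suc 0) < k"
    using graph_automorphism_edge_iff[OF \<phi>, of 0 "Suc 0"] k by (auto simp: edge_path_graph_iff)
  from end_vertex show ?thesis
  proof
    assume "\<phi> 0 = 0"
    then show ?thesis
      using path_graph_automorphism_eqI[OF \<phi> graph_automorphism_id] next_vertex by auto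
  next
    assume "\<phi> 0 = k - 1"
    then show ?thesis
      using path_graph_automorphism_eqI[OF \<phi> graph_automorphism_path_reversal] next_vertex k
      by auto
  qed
qed

lemma distinguishing_path_graphI:
  assumes "2 \<le> k" "i < k" "f (k - 1 - i) \<noteq> f i"
  shows "distinguishing (path_graph k) f"
  unfolding distinguishing_def
proof (intro allI impI, elim conjE)
  fix \<phi>
  assume "graph_automorphism (path_graph k) \<phi>"
    and "\<forall>v\<in>vertices (path_graph k). f (\<phi> v) = f v"
  then show "\<forall>v\<in>vertices (path_graph k). \<phi> v = v"
    using path_graph_automorphism_cases[of k \<phi>] assms by force
qed

section \<open>Values for paths\<close>

lemma list_distinguishing_chromatic_number_path_even:
  assumes t: "1 \<le> t"
  shows "list_distinguishing_chromatic_number (path_graph (2 * t)) = 2"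
proof -
  have "list_distinguishing_chromatic_number (path_graph (2 * t)) = Suc 1"
  proof (rule list_distinguishing_chromatic_number_eq_Suc)
    have False if "proper_coloring (path_graph (2 * t)) f" "\<forall>i<2 * t. f i < 1" for f :: "nat \<Rightarrow> nat"
    proof -
      have "f 0 \<noteq> f (Suc 0)"
        using that(1) t by (simp add: proper_coloring_path_graph_iff)
      then show False
        using that(2)[rule_format, of 0] that(2)[rule_format, of 1] t by simp
    qed
    then show "\<not> properly_list_distinguishable (path_graph (2 * t)) (\<lambda>_. {..<1::nat})"
      unfolding properly_list_distinguishable_def by force
  next
    fix L :: "nat \<Rightarrow> nat set"
    assume L: "\<forall>v\<in>vertices (path_graph (2 * t)). finite (L v) \<and> card (L v) = Suc 1"
    then have "card (L 0) = 2"
      using t by simp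
    then have "L 0 \<noteq> {}"
      by force
    then obtain f where f: "\<forall>i<2 * t. f i \<in> L i" "\<forall>i. Suc i < 2 * t \<longrightarrow> f (Suc i) \<noteq> f i"
      using greedy_sequence[of L "2 * t"] L by auto
    \<comment> \<open>The mirror image of \<open>t\<close> is its neighbour \<open>t - 1\<close>, so
      every proper coloring breaks the reversal.\<close>
    have "f (2 * t - 1 - t) \<noteq> f t"
      using f(2)[rule_format, of "t - 1"] t by (simp add: mult_2)
    then have "distinguishing (path_graph (2 * t)) f"
      using t by (intro distinguishing_path_graphI[of _ t]) auto
    moreover have "proper_coloring (path_graph (2 * t)) f"
      using f(2) by (metis proper_coloring_path_graph_iff)
    ultimately show "properly_list_distinguishable (path_graph (2 * t)) L"
      using f(1) unfolding properly_list_distinguishable_def by auto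
  qed
  then show ?thesis
    by simp
qed

lemma list_distinguishing_chromatic_number_path_odd:
  assumes t: "1 \<le> t"
  shows "list_distinguishing_chromatic_number (path_graph (2 * t + 1)) = 3"
proof -
  let ?G = "path_graph (2 * t + 1)"
  have "list_distinguishing_chromatic_number ?G = Suc 2"
  proof (rule list_distinguishing_chromatic_number_eq_Suc)
    have "\<not> distinguishing ?G f"
      if proper: "proper_coloring ?G f" and f: "\<forall>i<2 * t + 1. f i < 2" for f :: "nat \<Rightarrow> nat"
    proof (rule not_distinguishingI[OF graph_automorphism_path_reversal])
      have alt: "f i = (f 0 + i) mod 2" if "i < 2 * t + 1" for i
        using proper f that
        by (intro two_coloring_alternates) (auto simp: proper_coloring_path_graph_iff)
      show "f (2 * t + 1 - 1 - v) = f v" if "v \<in> vertices ?G" for v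
      proof -
        \<comment> \<open>Mirror images \<open>v\<close> and \<open>2 * t - v\<close> have the same
          parity, so the alternating coloring is invariant under reversal.\<close>
        have "(f 0 + (2 * t - v)) mod 2 = (f 0 + v) mod 2"
          using that by (simp add: mod2_eq_if)
        then show ?thesis
          using alt[of v] alt[of "2 * t - v"] that by simp
      qed
      show "0 \<in> vertices ?G" "2 * t + 1 - 1 - 0 \<noteq> 0"
        using t by auto
    qed
    then show "\<not> properly_list_distinguishable ?G (\<lambda>_. {..<2::nat})"
      by (auto simp: properly_list_distinguishable_def)
  next
    fix L :: "nat \<Rightarrow> nat set"
    assume L: "\<forall>v\<in>vertices ?G. finite (L v) \<and> card (L v) = Suc 2"
    then have "card (L 0) = 3"
      by simp
    then have "L 0 \<noteq> {}"
      by force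
    then obtain g where g: "\<forall>i<2 * t. g i \<in> L i" "\<forall>i. Suc i < 2 * t \<longrightarrow> g (Suc i) \<noteq> g i"
      using greedy_sequence[of L "2 * t"] L by auto
    \<comment> \<open>The last vertex must avoid two colors: that of its predecessor for properness,
      and that of vertex 0 to break the reversal.\<close>
    have "3 \<le> card (L (2 * t))"
      using L by simp
    then obtain y where y: "y \<in> L (2 * t)" "y \<noteq> g (2 * t - 1)" "y \<noteq> g 0"
      using ex_avoiding_two[of "L (2 * t)" "g (2 * t - 1)" "g 0"] by blast
    define f where "f = g(2 * t := y)"
    have "f i \<noteq> f (Suc i)" if "Suc i < 2 * t + 1" for i
    proof (cases "Suc i = 2 * t")
      case True
      then have "i = 2 * t - 1"
        by simp
      then show ?thesis
        using y(2) True by (auto simp: f_def)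
    next
      case False
      then have "Suc i < 2 * t"
        using that by simp
      then show ?thesis
        using g(2)[rule_format, of i] by (auto simp: f_def)
    qed
    then have "proper_coloring ?G f"
      by (simp add: proper_coloring_path_graph_iff)
    moreover have "distinguishing ?G f"
      using y(3) t by (intro distinguishing_path_graphI[of _ 0]) (auto simp: f_def)
    moreover have "\<forall>v\<in>vertices ?G. f v \<in> L v"
      using g(1) y(1) by (auto simp: f_def less_Suc_eq)
    ultimately show "properly_list_distinguishable ?G L"
      unfolding properly_list_distinguishable_def by blast
  qed
  then show ?thesis
    by simp
qed

section \<open>Cycles\<close>

lemma vertices_cycle_graph [simp]: "vertices (cycle_graph n) = {..<n}"
  by (simp add: cycle_graph_def)

text \<open>Trading \<open>mod\<close> for an explicit closing edge between 0 and
  \<open>n - 1\<close> reduces later adjacency questions to linear arithmetic.\<close>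

lemma edge_cycle_graph_iff:
  assumes "2 \<le> n"
  shows "{u, v} \<in> edges (cycle_graph n) \<longleftrightarrow> u < n \<and> v < n \<and>
    (v = Suc u \<or> u = Suc v \<or> u = 0 \<and> Suc v = n \<or> v = 0 \<and> Suc u = n)"
proof -
  have mod: "Suc i mod n = (if Suc i = n then 0 else Suc i)" if "i < n" for i
    using that by auto
  have "{u, v} \<in> edges (cycle_graph n) \<longleftrightarrow>
      (\<exists>i<n. (u = i \<and> v = Suc i mod n) \<or> (v = i \<and> u = Suc i mod n))"
    by (auto simp: cycle_graph_def doubleton_eq_iff)
  also have "\<dots> \<longleftrightarrow> (u < n \<and> v = Suc u mod n) \<or> (v < n \<and> u = Suc v mod n)"
    by blast
  also have "\<dots> \<longleftrightarrow> u < n \<and> v < n \<and>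
      (v = Suc u \<or> u = Suc v \<or> u = 0 \<and> Suc v = n \<or> v = 0 \<and> Suc u = n)"
    using assms mod[of u] mod[of v] by (auto split: if_splits)
  finally show ?thesis .
qed

lemma proper_coloring_cycle_graph_iff:
  assumes "2 \<le> n"
  shows "proper_coloring (cycle_graph n) f \<longleftrightarrow>
    (\<forall>i. Suc i < n \<longrightarrow> f i \<noteq> f (Suc i)) \<and> f (n - 1) \<noteq> f 0"
proof
  assume "proper_coloring (cycle_graph n) f"
  then have *: "f u \<noteq> f v" if "{u, v} \<in> edges (cycle_graph n)" for u v
    using assms that by (auto simp: proper_coloring_def edge_cycle_graph_iff)
  show "(\<forall>i. Suc i < n \<longrightarrow> f i \<noteq> f (Suc i)) \<and> f (n - 1) \<noteq> f 0"
    using assms by (intro conjI allI impI *) (auto simp: edge_cycle_graph_iff)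
next
  assume *: "(\<forall>i. Suc i < n \<longrightarrow> f i \<noteq> f (Suc i)) \<and> f (n - 1) \<noteq> f 0"
  have "v = n - 1" if "Suc v = n" for v
    using that by simp
  then show "proper_coloring (cycle_graph n) f"
    using assms * by (auto simp: proper_coloring_def edge_cycle_graph_iff)
qed

lemma cycle_graph_automorphism_idI:
  assumes n: "3 \<le> n" and \<phi>: "graph_automorphism (cycle_graph n) \<phi>"
    and "\<phi> 0 = 0" "\<phi> (Suc 0) = Suc 0" "i < n"
  shows "\<phi> i = i"
  by (rule graph_automorphism_eqI_max_degree_2[OF _ _ _ \<phi> graph_automorphism_id])
    (use assms in \<open>auto simp: edge_cycle_graph_iff\<close>)

lemma cycle_graph_automorphism_adjacent:
  assumes "2 \<le> n" "graph_automorphism (cycle_graph n) \<phi>" "Suc i < n"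
  shows "\<phi> i < n \<and> \<phi> (Suc i) < n \<and> (\<phi> (Suc i) = Suc (\<phi> i) \<or> \<phi> i = Suc (\<phi> (Suc i)) \<or>
    \<phi> i = 0 \<and> Suc (\<phi> (Suc i)) = n \<or> \<phi> (Suc i) = 0 \<and> Suc (\<phi> i) = n)"
  using graph_automorphism_edge_iff[OF assms(2), of i "Suc i"] assms
  by (simp add: edge_cycle_graph_iff)

lemma graph_automorphism_cycle_rotation:
  assumes "2 \<le> n" "s < n"
  shows "graph_automorphism (cycle_graph n) (\<lambda>i. if i + s < n then i + s else i + s - n)"
  unfolding graph_automorphism_def
proof (intro conjI ballI)
  show "bij_betw (\<lambda>i. if i + s < n then i + s else i + s - n)
      (vertices (cycle_graph n)) (vertices (cycle_graph n))"
    using assms by (intro bij_betw_byWitness[where f' = "\<lambda>i. if s \<le> i then i - s else i + n - s"])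
      (auto split: if_splits)
qed (use assms in \<open>auto simp: edge_cycle_graph_iff split: if_splits\<close>)

text \<open>This is \<open>i \<mapsto> s - i\<close> modulo \<open>n\<close>. For even
  \<open>s\<close> the axis passes through vertex \<open>s div 2\<close>.\<close>

lemma graph_automorphism_cycle_reflection:
  assumes "2 \<le> n" "s < n"
  shows "graph_automorphism (cycle_graph n) (\<lambda>i. if i \<le> s then s - i else s + n - i)"
  by (rule graph_automorphism_involution)
    (use assms in \<open>auto simp: edge_cycle_graph_iff split: if_splits\<close>)

text \<open>The unique color fixes vertex 0, so vertex 1 can only go to 1 or \<open>n - 1\<close>.
  The colors exclude the latter, and an automorphism fixing 0 and 1 is the identity.\<close>

lemma distinguishing_cycle_graphI:
  assumes n: "3 \<le> n" and unique: "\<And>i. 0 < i \<Longrightarrow> i < n \<Longrightarrow> f i \<noteq> f 0"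
    and nbrs: "f 1 \<noteq> f (n - 1)"
  shows "distinguishing (cycle_graph n) f"
  unfolding distinguishing_def
proof (intro allI impI ballI, elim conjE)
  fix \<phi> v
  assume \<phi>: "graph_automorphism (cycle_graph n) \<phi>"
    and fixed: "\<forall>v\<in>vertices (cycle_graph n). f (\<phi> v) = f v"
    and v: "v \<in> vertices (cycle_graph n)"
  have adj: "\<phi> 0 < n \<and> \<phi> (Suc 0) < n \<and> (\<phi> (Suc 0) = Suc (\<phi> 0) \<or> \<phi> 0 = Suc (\<phi> (Suc 0)) \<or>
    \<phi> 0 = 0 \<and> Suc (\<phi> (Suc 0)) = n \<or> \<phi> (Suc 0) = 0 \<and> Suc (\<phi> 0) = n)"
    using cycle_graph_automorphism_adjacent[OF _ \<phi>, of 0] n by simp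
  have "f (\<phi> 0) = f 0" "f (\<phi> 1) = f 1"
    using fixed n by auto
  then have "\<phi> 0 = 0" "\<phi> 1 \<noteq> n - 1"
    using unique[of "\<phi> 0"] adj nbrs by auto
  then have "\<phi> (Suc 0) = Suc 0"
    using adj n by auto
  then show "\<phi> v = v"
    using cycle_graph_automorphism_idI[OF n \<phi> \<open>\<phi> 0 = 0\<close>] v by simp
qed

section \<open>Constructing colorings of cycles\<close>

lemma cycle_properly_list_distinguishable_if_differing_ends:
  assumes n: "3 \<le> n" and L: "\<And>i. i < n \<Longrightarrow> finite (L i) \<and> 3 \<le> card (L i)"
    and c: "c \<in> L 0" "c \<notin> L (n - 1)"
  shows "properly_list_distinguishable (cycle_graph n) L"
proof -
  \<comment> \<open>The singleton prescribes \<open>c\<close> at vertex 0. Deleting \<open>c\<close>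
    elsewhere makes that color unique and still leaves two choices at each inner vertex.\<close>
  define M where "M = (\<lambda>i. if i = 0 then {c} else L i - {c})"
  have "finite (M i) \<and> 2 \<le> card (M i)" if "0 < i" "i < n - 1" for i
  proof -
    have "card (L i) - 1 \<le> card (L i - {c})"
      by (simp add: card_Diff_singleton_if)
    then show ?thesis
      using L[of i] that unfolding M_def by simp linarith
  qed
  then obtain g where g: "\<forall>i<n - 1. g i \<in> M i" "\<forall>i. Suc i < n - 1 \<longrightarrow> g (Suc i) \<noteq> g i"
    using greedy_sequence[of M "n - 1"] by (auto simp: M_def)
  \<comment> \<open>Vertex \<open>n - 1\<close> avoids its predecessor, for properness, and vertex
    1, to separate the neighbours of 0. It differs from vertex 0 automatically, since
    \<open>c\<close> is missing from its list.\<close>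
  obtain y where y: "y \<in> L (n - 1)" "y \<noteq> g (n - 2)" "y \<noteq> g 1"
    using ex_avoiding_two[of "L (n - 1)"] L[of "n - 1"] n by fastforce
  define f where "f = g(n - 1 := y)"
  have f0: "f 0 = c"
    using g(1)[rule_format, of 0] n by (auto simp: f_def M_def)
  have unique: "f i \<noteq> f 0" if "0 < i" "i < n" for i
    using g(1)[rule_format, of i] f0 y(1) c(2) that
    by (cases "i = n - 1") (auto simp: f_def M_def)
  have "f i \<noteq> f (Suc i)" if "Suc i < n" for i
  proof (cases "Suc i = n - 1")
    case True
    then have "i = n - 2"
      by simp
    then show ?thesis
      using y(2) True by (auto simp: f_def)
  next
    case False
    then have "Suc i < n - 1" "i \<noteq> n - 1"
      using that by linarith+
    then show ?thesis
      using g(2)[rule_format, of i] False by (auto simp: f_def)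
  qed
  then have "proper_coloring (cycle_graph n) f"
    using unique[of "n - 1"] n by (simp add: proper_coloring_cycle_graph_iff)
  moreover have "distinguishing (cycle_graph n) f"
    using n unique y(3) by (intro distinguishing_cycle_graphI) (auto simp: f_def)
  moreover have "f i \<in> L i" if "i < n" for i
    using g(1)[rule_format, of i] y(1) c(1) that
    by (cases "i = 0"; cases "i = n - 1") (auto simp: f_def M_def)
  ultimately show ?thesis
    unfolding properly_list_distinguishable_def by auto
qed

lemma cycle_properly_list_distinguishable_if_nonconstant:
  assumes n: "3 \<le> n" and k: "3 \<le> k" and L: "\<And>i. i < n \<Longrightarrow> finite (L i) \<and> card (L i) = k"
    and j: "j < n" "L j \<noteq> L 0"
  shows "properly_list_distinguishable (cycle_graph n) L"
proof -
  obtain x where x: "Suc x < n" "L (Suc x) \<noteq> L x"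
  proof (rule ccontr)
    assume "\<not> thesis"
    then have step: "L (Suc i) = L i" if "Suc i < n" for i
      using \<open>\<And>x. Suc x < n \<Longrightarrow> L (Suc x) \<noteq> L x \<Longrightarrow> thesis\<close> that by blast
    have "i < n \<Longrightarrow> L i = L 0" for i
      by (induction i) (auto simp: step)
    then show False
      using j by blast
  qed
  \<comment> \<open>Both lists have \<open>k\<close> elements, so an inclusion would be an
    equality.\<close>
  have "\<not> L (Suc x) \<subseteq> L x"
    using card_subset_eq[of "L x" "L (Suc x)"] L x by auto
  then obtain c where c: "c \<in> L (Suc x)" "c \<notin> L x"
    by blast
  \<comment> \<open>This rotation sends 0 to \<open>Suc x\<close> and \<open>n - 1\<close> to
    \<open>x\<close>, bringing the differing lists to the ends.\<close>
  define \<rho> where "\<rho> = (\<lambda>i. if i + Suc x < n then i + Suc x else i + Suc x - n)"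
  have "graph_automorphism (cycle_graph n) \<rho>"
    unfolding \<rho>_def using n x(1) by (intro graph_automorphism_cycle_rotation) auto
  moreover have "properly_list_distinguishable (cycle_graph n) (L \<circ> \<rho>)"
  proof (rule cycle_properly_list_distinguishable_if_differing_ends[OF n])
    show "finite ((L \<circ> \<rho>) i) \<and> 3 \<le> card ((L \<circ> \<rho>) i)" if "i < n" for i
      using L[of "\<rho> i"] k that x by (auto simp: \<rho>_def)
    show "c \<in> (L \<circ> \<rho>) 0" "c \<notin> (L \<circ> \<rho>) (n - 1)"
      using c x n by (auto simp: \<rho>_def)
  qed
  ultimately show ?thesis
    by (rule properly_list_distinguishable_automorphism)
qed

text \<open>Because \<open>n - 1\<close> is even, the alternating part begins with \<open>a\<close>
  and ends with \<open>b\<close>, so the neighbours of the unique \<open>c\<close> get different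
  colors.\<close>

lemma cycle_properly_list_distinguishable_if_constant_odd:
  assumes n: "3 \<le> n" "odd n" and L: "\<And>i. i < n \<Longrightarrow> L i = C" and C: "card C = 3"
  shows "properly_list_distinguishable (cycle_graph n) L"
proof -
  obtain a b c where abc: "C = {a, b, c}" "a \<noteq> b" "a \<noteq> c" "b \<noteq> c"
    using C by (auto simp: card_3_iff)
  define f where "f = (\<lambda>i::nat. if i = 0 then c else if odd i then a else b)"
  have "proper_coloring (cycle_graph n) f"
    using abc n by (auto simp: proper_coloring_cycle_graph_iff f_def)
  moreover have "distinguishing (cycle_graph n) f"
    using abc n by (intro distinguishing_cycle_graphI) (auto simp: f_def)
  moreover have "\<forall>v\<in>vertices (cycle_graph n). f v \<in> L v"
    using L abc by (auto simp: f_def)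
  ultimately show ?thesis
    unfolding properly_list_distinguishable_def by blast
qed

text \<open>For even \<open>n\<close> an alternating part on 1, ..., \<open>n - 1\<close> would
  begin and end alike. The fourth color \<open>d\<close> at vertex 1 differs from the
  \<open>b\<close> at \<open>n - 1\<close>.\<close>

lemma cycle_properly_list_distinguishable_if_constant_four:
  assumes n: "3 \<le> n" "even n" and L: "\<And>i. i < n \<Longrightarrow> L i = C" and C: "card C = 4"
  shows "properly_list_distinguishable (cycle_graph n) L"
proof -
  have "card C = Suc 3"
    using C by simp
  then obtain d D where D: "C = insert d D" "d \<notin> D" "card D = 3"
    by (meson card_Suc_eq)
  then obtain a b c where abc: "D = {a, b, c}" "a \<noteq> b" "a \<noteq> c" "b \<noteq> c"
    by (auto simp: card_3_iff)
  define f where "f = (\<lambda>i::nat. if i = 0 then c else if i = 1 then d else if even i then a else b)"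
  have "proper_coloring (cycle_graph n) f"
    using abc D n by (auto simp: proper_coloring_cycle_graph_iff f_def)
  moreover have "distinguishing (cycle_graph n) f"
    using abc D n by (intro distinguishing_cycle_graphI) (auto simp: f_def)
  moreover have "\<forall>v\<in>vertices (cycle_graph n). f v \<in> L v"
    using L abc D by (auto simp: f_def)
  ultimately show ?thesis
    unfolding properly_list_distinguishable_def by blast
qed

text \<open>Color \<open>c\<close> occurs exactly at 0 and 3, so an automorphism preserving
  \<open>f\<close> fixes or swaps these vertices. If it fixes 0, the neighbours 1 and
  \<open>n - 1\<close> with colors \<open>a\<close> and \<open>b\<close> force the identity.\<close>

lemma cycle_properly_list_distinguishable_if_constant_even:
  assumes n: "8 \<le> n" "even n" and L: "\<And>i. i < n \<Longrightarrow> L i = C" and C: "card C = 3"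
  shows "properly_list_distinguishable (cycle_graph n) L"
proof -
  obtain a b c where abc: "C = {a, b, c}" "a \<noteq> b" "a \<noteq> c" "b \<noteq> c"
    using C by (auto simp: card_3_iff)
  define f where "f = (\<lambda>i::nat. if i = 0 \<or> i = 3 then c else if i = 1 then a else if i = 2 then b
    else if even i then a else b)"
  have f_c: "f i = c \<longleftrightarrow> i = 0 \<or> i = 3" for i
    using abc by (auto simp: f_def)
  have f_vals: "f 1 = a" "f 2 = b" "f 4 = a" "f (n - 1) = b"
    using n by (auto simp: f_def)
  have "f i \<noteq> f (Suc i)" for i
  proof (cases "i < 4")
    case True
    then have "i = 0 \<or> i = 1 \<or> i = 2 \<or> i = 3"
      by auto
    then show ?thesis
      using abc by (auto simp: f_def)
  next
    case False
    then show ?thesis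
      using abc by (auto simp: f_def)
  qed
  then have "proper_coloring (cycle_graph n) f"
    using f_vals f_c[of 0] abc n by (auto simp: proper_coloring_cycle_graph_iff)
  moreover have "distinguishing (cycle_graph n) f"
    unfolding distinguishing_def
  proof (intro allI impI ballI, elim conjE)
    fix \<phi> v
    assume \<phi>: "graph_automorphism (cycle_graph n) \<phi>"
      and "\<forall>v\<in>vertices (cycle_graph n). f (\<phi> v) = f v"
      and v: "v \<in> vertices (cycle_graph n)"
    then have fixed: "f (\<phi> 0) = c" "f (\<phi> 1) = a" "f (\<phi> 2) = b" "f (\<phi> 3) = c"
      using n by (auto simp: f_def)
    have adj: "\<phi> i < n \<and> \<phi> (Suc i) < n \<and> (\<phi> (Suc i) = Suc (\<phi> i) \<or> \<phi> i = Suc (\<phi> (Suc i)) \<or>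
        \<phi> i = 0 \<and> \<phi> (Suc i) = n - 1 \<or> \<phi> (Suc i) = 0 \<and> \<phi> i = n - 1)" if "i < 3" for i
      using cycle_graph_automorphism_adjacent[OF _ \<phi>, of i] n that by auto
    have "\<phi> 0 \<noteq> \<phi> 3"
      using graph_automorphism_eq_iff[OF \<phi>, of 0 3] n by simp
    then consider "\<phi> 0 = 0" | "\<phi> 0 = 3" "\<phi> 3 = 0"
      using fixed f_c by metis
    then show "\<phi> v = v"
    proof cases
      case 1
      have "\<phi> 1 \<noteq> n - 1"
        using fixed(2) f_vals abc by metis
      then have "\<phi> (Suc 0) = Suc 0"
        using adj[of 0] 1 n by auto
      then show ?thesis
        using cycle_graph_automorphism_idI[OF _ \<phi> 1] v n by simp
    next
      case 2
      \<comment> \<open>After a swap, 1 must go to the neighbour of 3 colored \<open>a\<close>,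
        which is 4, and 2 to the neighbour of 0 colored \<open>b\<close>, which is
        \<open>n - 1\<close>. These are not adjacent for \<open>n \<ge> 8\<close>; for
        \<open>n = 6\<close> they would be, and the pattern would have a half-turn symmetry.\<close>
      have "\<phi> 1 \<noteq> 2" "\<phi> 2 \<noteq> 1"
        using fixed f_vals abc by metis+
      then have "\<phi> 1 = 4" "\<phi> 2 = n - 1"
        using adj[of 0] adj[of 2] 2 n by (auto simp: numeral_eq_Suc)
      then show ?thesis
        using adj[of 1] n by (auto simp: numeral_eq_Suc)
    qed
  qed
  moreover have "\<forall>v\<in>vertices (cycle_graph n). f v \<in> L v"
    using L abc by (auto simp: f_def)
  ultimately show ?thesis
    unfolding properly_list_distinguishable_def by blast
qed

section \<open>Lower bounds for cycles\<close>

lemma cycle_not_properly_2_distinguishable: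
  assumes n: "3 \<le> n"
  shows "\<not> properly_list_distinguishable (cycle_graph n) (\<lambda>_. {..<2::nat})"
proof -
  let ?G = "cycle_graph n"
  have "\<not> distinguishing ?G f"
    if proper: "proper_coloring ?G f" and f: "\<forall>i<n. f i < 2" for f :: "nat \<Rightarrow> nat"
  proof (rule not_distinguishingI[OF graph_automorphism_cycle_reflection])
    have alt: "f i = (f 0 + i) mod 2" if "i < n" for i
      using proper f that n
      by (intro two_coloring_alternates) (auto simp: proper_coloring_cycle_graph_iff)
    \<comment> \<open>The closing edge is compatible with alternation only for even
      \<open>n\<close>; then \<open>v \<mapsto> n - v\<close> preserves parity and with it the
      coloring.\<close>
    have "f (n - 1) \<noteq> f 0"
      using proper n by (simp add: proper_coloring_cycle_graph_iff)
    then have "even n"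
      using alt[of "n - 1"] alt[of 0] n by (auto simp: mod2_eq_if split: if_splits)
    show "f (if v \<le> 0 then 0 - v else 0 + n - v) = f v" if "v \<in> vertices ?G" for v
    proof (cases "v = 0")
      case False
      have "(f 0 + (n - v)) mod 2 = (f 0 + v) mod 2"
        using that \<open>even n\<close> by (simp add: mod2_eq_if)
      then show ?thesis
        using alt[of v] alt[of "n - v"] that False by simp
    qed simp
    show "1 \<in> vertices ?G" "(if 1 \<le> (0::nat) then 0 - 1 else 0 + n - 1) \<noteq> 1" "2 \<le> n" "0 < n"
      using n by auto
  qed
  then show ?thesis
    by (auto simp: properly_list_distinguishable_def)
qed

lemma cycle_4_not_properly_3_distinguishable:
  "\<not> properly_list_distinguishable (cycle_graph 4) (\<lambda>_. {..<3::nat})"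
proof -
  let ?G = "cycle_graph 4"
  have "\<not> distinguishing ?G f"
    if proper: "proper_coloring ?G f" and f: "\<forall>i<4. f i < 3" for f :: "nat \<Rightarrow> nat"
  proof -
    have V: "v \<in> vertices ?G \<longleftrightarrow> v = 0 \<or> v = 1 \<or> v = 2 \<or> v = 3" for v
      by auto
    have lt: "f 0 < 3" "f 1 < 3" "f 2 < 3" "f 3 < 3"
      using f by auto
    have "f i \<noteq> f (Suc i)" if "Suc i < 4" for i
      using proper that by (simp add: proper_coloring_cycle_graph_iff)
    from this[of 0] this[of 1] this[of 2]
    have "f 0 \<noteq> f 1" "f 1 \<noteq> f 2" "f 2 \<noteq> f 3"
      by (auto simp: numeral_eq_Suc)
    moreover have "f 3 \<noteq> f 0"
      using proper by (simp add: proper_coloring_cycle_graph_iff)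
    \<comment> \<open>If 1 and 3 have different colors, their common neighbours 0 and 2 must both
      take the third. The equally colored opposite pair is swapped by a reflection fixing the other
      two vertices.\<close>
    ultimately consider "f 1 = f 3" | "f 0 = f 2"
      using lt by linarith
    then show ?thesis
    proof cases
      case 1
      show ?thesis
        by (rule not_distinguishingI[OF graph_automorphism_cycle_reflection[of 4 0], of _ 1])
          (use 1 in \<open>auto simp: V simp del: vertices_cycle_graph\<close>)
    next
      case 2
      show ?thesis
        by (rule not_distinguishingI[OF graph_automorphism_cycle_reflection[of 4 2], of _ 0])
          (use 2 in \<open>auto simp: V simp del: vertices_cycle_graph\<close>)
    qed
  qed
  then show ?thesis
    by (auto simp: properly_list_distinguishable_def)
qed

text \<open>The alternatives express invariance under the three reflections through opposite
  vertices and under the half turn. They are verified by running through the values 0, 1, 2.\<close>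

lemma proper_3_coloring_hexagon_symmetric:
  fixes c0 c1 c2 c3 c4 c5 :: nat
  assumes neq: "c0 \<noteq> c1" "c1 \<noteq> c2" "c2 \<noteq> c3" "c3 \<noteq> c4" "c4 \<noteq> c5" "c5 \<noteq> c0"
    and "c0 < 3" "c1 < 3" "c2 < 3" "c3 < 3" "c4 < 3" "c5 < 3"
  shows "c1 = c5 \<and> c2 = c4 \<or> c0 = c2 \<and> c3 = c5 \<or> c0 = c4 \<and> c1 = c3 \<or>
    c0 = c3 \<and> c1 = c4 \<and> c2 = c5"
proof -
  have "c = 0 \<or> c = 1 \<or> c = 2" if "c < 3" for c :: nat
    using that by auto
  note assms(7-12)[THEN this]
  then show ?thesis
    using neq by fastforce
qed

lemma cycle_6_not_properly_3_distinguishable: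
  "\<not> properly_list_distinguishable (cycle_graph 6) (\<lambda>_. {..<3::nat})"
proof -
  let ?G = "cycle_graph 6"
  have "\<not> distinguishing ?G f"
    if proper: "proper_coloring ?G f" and f: "\<forall>i<6. f i < 3" for f :: "nat \<Rightarrow> nat"
  proof -
    have V: "v \<in> vertices ?G \<longleftrightarrow> v = 0 \<or> v = 1 \<or> v = 2 \<or> v = 3 \<or> v = 4 \<or> v = 5" for v
      by auto
    have lt: "f 0 < 3" "f 1 < 3" "f 2 < 3" "f 3 < 3" "f 4 < 3" "f 5 < 3"
      using f by auto
    have "f i \<noteq> f (Suc i)" if "Suc i < 6" for i
      using proper that by (simp add: proper_coloring_cycle_graph_iff)
    from this[of 0] this[of 1] this[of 2] this[of 3] this[of 4]
    have "f 0 \<noteq> f 1" "f 1 \<noteq> f 2" "f 2 \<noteq> f 3" "f 3 \<noteq> f 4" "f 4 \<noteq> f 5"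
      by (auto simp: numeral_eq_Suc)
    moreover have "f 5 \<noteq> f 0"
      using proper by (simp add: proper_coloring_cycle_graph_iff)
    ultimately have "f 1 = f 5 \<and> f 2 = f 4 \<or> f 0 = f 2 \<and> f 3 = f 5 \<or>
        f 0 = f 4 \<and> f 1 = f 3 \<or> f 0 = f 3 \<and> f 1 = f 4 \<and> f 2 = f 5"
      using lt by (intro proper_3_coloring_hexagon_symmetric)
    then consider "f 1 = f 5" "f 2 = f 4" | "f 0 = f 2" "f 3 = f 5" | "f 0 = f 4" "f 1 = f 3"
      | "f 0 = f 3" "f 1 = f 4" "f 2 = f 5"
      by blast
    \<comment> \<open>The witnesses are the reflections with \<open>s = 0\<close>,
      \<open>s = 2\<close>, \<open>s = 4\<close> and the rotation by 3, in the order of the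
      alternatives.\<close>
    then show ?thesis
    proof cases
      case 1
      show ?thesis
        by (rule not_distinguishingI[OF graph_automorphism_cycle_reflection[of 6 0], of _ 1])
          (use 1 in \<open>auto simp: V simp del: vertices_cycle_graph\<close>)
    next
      case 2
      show ?thesis
        by (rule not_distinguishingI[OF graph_automorphism_cycle_reflection[of 6 2], of _ 0])
          (use 2 in \<open>auto simp: V simp del: vertices_cycle_graph\<close>)
    next
      case 3
      show ?thesis
        by (rule not_distinguishingI[OF graph_automorphism_cycle_reflection[of 6 4], of _ 0])
          (use 3 in \<open>auto simp: V simp del: vertices_cycle_graph\<close>)
    next
      case 4
      show ?thesis
        by (rule not_distinguishingI[OF graph_automorphism_cycle_rotation[of 6 3], of _ 0])
          (use 4 in \<open>auto simp: V simp del: vertices_cycle_graph\<close>)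
    qed
  qed
  then show ?thesis
    by (auto simp: properly_list_distinguishable_def)
qed

section \<open>Values for cycles\<close>

text \<open>Nonconstant lists are handled uniformly for all lengths from 3 on; the length
  restriction comes from constant lists of three colors.\<close>

lemma list_distinguishing_chromatic_number_cycle_eq_3:
  assumes "odd n \<and> 3 \<le> n \<or> even n \<and> 8 \<le> n"
  shows "list_distinguishing_chromatic_number (cycle_graph n) = 3"
proof -
  have n: "3 \<le> n"
    using assms by auto
  have "list_distinguishing_chromatic_number (cycle_graph n) = Suc 2"
  proof (rule list_distinguishing_chromatic_number_eq_Suc[OF cycle_not_properly_2_distinguishable[OF n]])
    fix L :: "nat \<Rightarrow> nat set"
    assume "\<forall>v\<in>vertices (cycle_graph n). finite (L v) \<and> card (L v) = Suc 2"
    then have L: "finite (L i) \<and> card (L i) = 3" if "i < n" for i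
      using that by simp
    show "properly_list_distinguishable (cycle_graph n) L"
    proof (cases "\<forall>i<n. L i = L 0")
      case True
      then have const: "L i = L 0" if "i < n" for i
        using that by blast
      have "card (L 0) = 3"
        using L[of 0] n by simp
      then show ?thesis
        using assms cycle_properly_list_distinguishable_if_constant_odd[of n L, OF _ _ const]
          cycle_properly_list_distinguishable_if_constant_even[of n L, OF _ _ const] by blast
    next
      case False
      then show ?thesis
        using cycle_properly_list_distinguishable_if_nonconstant[of n 3 L] n L by auto
    qed
  qed
  then show ?thesis
    by simp
qed

text \<open>The hypothesis \<open>lower\<close> singles out the lengths 4 and 6, because three
  colors suffice for every even length from 8 on.\<close>

lemma list_distinguishing_chromatic_number_cycle_eq_4:
  assumes n: "3 \<le> n" "even n"
    and lower: "\<not> properly_list_distinguishable (cycle_graph n) (\<lambda>_. {..<3::nat})"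
  shows "list_distinguishing_chromatic_number (cycle_graph n) = 4"
proof -
  have "list_distinguishing_chromatic_number (cycle_graph n) = Suc 3"
  proof (rule list_distinguishing_chromatic_number_eq_Suc[OF lower])
    fix L :: "nat \<Rightarrow> nat set"
    assume "\<forall>v\<in>vertices (cycle_graph n). finite (L v) \<and> card (L v) = Suc 3"
    then have L: "finite (L i) \<and> card (L i) = 4" if "i < n" for i
      using that by simp
    show "properly_list_distinguishable (cycle_graph n) L"
    proof (cases "\<forall>i<n. L i = L 0")
      case True
      then have const: "L i = L 0" if "i < n" for i
        using that by blast
      have "card (L 0) = 4"
        using L[of 0] n by simp
      then show ?thesis
        using n cycle_properly_list_distinguishable_if_constant_four[of n L, OF _ _ const] by blast
    next
      case False
      then show ?thesis
        using cycle_properly_list_distinguishable_if_nonconstant[of n 4 L] n L by auto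
    qed
  qed
  then show ?thesis
    by simp
qed

theorem theorem2p7:
  shows "(\<forall>t::nat. t \<ge> 1 \<longrightarrow> list_distinguishing_chromatic_number (path_graph (2 * t)) = 2)
    \<and> (\<forall>t::nat. t \<ge> 1 \<longrightarrow> list_distinguishing_chromatic_number (path_graph (2 * t + 1)) = 3)
    \<and> list_distinguishing_chromatic_number (cycle_graph 4) = 4
    \<and> list_distinguishing_chromatic_number (cycle_graph 5) = 3
    \<and> list_distinguishing_chromatic_number (cycle_graph 6) = 4
    \<and> (\<forall>m::nat. m \<ge> 3 \<longrightarrow> list_distinguishing_chromatic_number (cycle_graph (2 * m + 1)) = 3)
    \<and> (\<forall>n::nat. n \<ge> 4 \<longrightarrow> list_distinguishing_chromatic_number (cycle_graph (2 * n)) = 3)"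
proof (intro conjI allI impI)
  show "list_distinguishing_chromatic_number (cycle_graph 4) = 4"
    by (rule list_distinguishing_chromatic_number_cycle_eq_4)
      (use cycle_4_not_properly_3_distinguishable in auto)
  show "list_distinguishing_chromatic_number (cycle_graph 6) = 4"
    by (rule list_distinguishing_chromatic_number_cycle_eq_4)
      (use cycle_6_not_properly_3_distinguishable in auto)
  show "list_distinguishing_chromatic_number (cycle_graph 5) = 3"
    by (rule list_distinguishing_chromatic_number_cycle_eq_3) simp
  show "list_distinguishing_chromatic_number (cycle_graph (2 * m + 1)) = 3" if "3 \<le> m" for m
    using that by (intro list_distinguishing_chromatic_number_cycle_eq_3) simp
  show "list_distinguishing_chromatic_number (cycle_graph (2 * n)) = 3" if "4 \<le> n" for n
    using that by (intro list_distinguishing_chromatic_number_cycle_eq_3) simp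
qed (rule list_distinguishing_chromatic_number_path_even
    list_distinguishing_chromatic_number_path_odd, assumption)+

end
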